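(* For each topological space $X$ there exist a Tychonoff space $Y$ and a ring isomorphism $B_1(Y)\to B_1(X)$ whose restriction to $B_1^*(Y)$ is a ring isomorphism of $B_1^*(Y)$ onto $B_1^*(X)$. In other words, $B_1(X)$ is isomorphic to $B_1(Y)$, and $B_1^*(X)$ is isomorphic to $B_1^*(Y)$ under the same (restricted) map.
   Context: For a topological space $X$, $C(X)$ is the ring of continuous functions $X\to\mathbb{R}$. A function $f:X\to\mathbb{R}$ is a Baire one function if it is the pointwise limit of a sequence of functions in $C(X)$. $B_1(X)$ is the commutative ring with unity (pointwise operations) of all Baire one functions on $X$, and $B_1^*(X)$ is its subring of bounded functions. A Tychonoff space is a completely regular Hausdorff space. *)

theory Defs
  imports "HOL-Analysis.Analysis" "HOL-Algebra.QuotRing" "HOL-Algebra.Subrings"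
begin

definition tychonoff_space :: "'a topology \<Rightarrow> bool"
  where "tychonoff_space X \<longleftrightarrow> completely_regular_space X \<and> Hausdorff_space X"

text \<open>
  A function on a space is represented by the extensional function on its underlying set (value
  \<open>undefined\<close> outside), so that equality in the rings below is equality of functions on the space.
\<close>

definition cont_funs :: "'a topology \<Rightarrow> ('a \<Rightarrow> real) set"
  where "cont_funs X = {f \<in> extensional (topspace X). continuous_map X euclideanreal f}"

definition baire_one_funs :: "'a topology \<Rightarrow> ('a \<Rightarrow> real) set"
  where "baire_one_funs X =
    {f \<in> extensional (topspace X).
       \<exists>s :: nat \<Rightarrow> 'a \<Rightarrow> real. (\<forall>n. s n \<in> cont_funs X) \<and>
         (\<forall>x \<in> topspace X. (\<lambda>n. s n x) \<longlonglongrightarrow> f x)}"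

definition B1 :: "'a topology \<Rightarrow> ('a \<Rightarrow> real) ring"
  where "B1 X =
    \<lparr>carrier = baire_one_funs X,
     mult = (\<lambda>f g. \<lambda>x\<in>topspace X. f x * g x),
     one = (\<lambda>x\<in>topspace X. 1),
     zero = (\<lambda>x\<in>topspace X. 0),
     add = (\<lambda>f g. \<lambda>x\<in>topspace X. f x + g x)\<rparr>"

definition B1_bounded :: "'a topology \<Rightarrow> ('a \<Rightarrow> real) ring"
  where "B1_bounded X =
    (B1 X)\<lparr>carrier := {f \<in> carrier (B1 X). bounded (f ` topspace X)}\<rparr>"

lemma baire_one_funsI:
  assumes "f \<in> extensional (topspace X)"
    and "\<And>n. continuous_map X euclideanreal (s n)"
    and "\<And>x. x \<in> topspace X \<Longrightarrow> (\<lambda>n. s n x) \<longlonglongrightarrow> f x"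
  shows "f \<in> baire_one_funs X"
proof -
  have "continuous_map X euclideanreal (restrict (s n) (topspace X))" for n
    using assms(2)[of n] by (rule continuous_map_eq) auto
  then show ?thesis
    using assms unfolding baire_one_funs_def cont_funs_def
    by (auto intro!: exI[of _ "\<lambda>n. restrict (s n) (topspace X)"])
qed

lemma baire_one_funsE:
  assumes "f \<in> baire_one_funs X"
  obtains s where "f \<in> extensional (topspace X)"
    and "\<And>n. continuous_map X euclideanreal (s n)"
    and "\<And>x. x \<in> topspace X \<Longrightarrow> (\<lambda>n. s n x) \<longlonglongrightarrow> f x"
  using assms unfolding baire_one_funs_def cont_funs_def by auto

lemma baire_one_funs_const: "(\<lambda>x\<in>topspace X. c) \<in> baire_one_funs X"
  by (rule baire_one_funsI[where s = "\<lambda>_ _. c"]) auto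

lemma baire_one_funs_add:
  assumes "f \<in> baire_one_funs X" "g \<in> baire_one_funs X"
  shows "(\<lambda>x\<in>topspace X. f x + g x) \<in> baire_one_funs X"
proof -
  obtain s where s: "\<And>n. continuous_map X euclideanreal (s n)"
      "\<And>x. x \<in> topspace X \<Longrightarrow> (\<lambda>n. s n x) \<longlonglongrightarrow> f x"
    using baire_one_funsE[OF assms(1)] by metis
  obtain t where t: "\<And>n. continuous_map X euclideanreal (t n)"
      "\<And>x. x \<in> topspace X \<Longrightarrow> (\<lambda>n. t n x) \<longlonglongrightarrow> g x"
    using baire_one_funsE[OF assms(2)] by metis
  show ?thesis
    by (rule baire_one_funsI[where s = "\<lambda>n x. s n x + t n x"])
      (auto intro!: continuous_map_add tendsto_add s t)
qed

lemma baire_one_funs_mult: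
  assumes "f \<in> baire_one_funs X" "g \<in> baire_one_funs X"
  shows "(\<lambda>x\<in>topspace X. f x * g x) \<in> baire_one_funs X"
proof -
  obtain s where s: "\<And>n. continuous_map X euclideanreal (s n)"
      "\<And>x. x \<in> topspace X \<Longrightarrow> (\<lambda>n. s n x) \<longlonglongrightarrow> f x"
    using baire_one_funsE[OF assms(1)] by metis
  obtain t where t: "\<And>n. continuous_map X euclideanreal (t n)"
      "\<And>x. x \<in> topspace X \<Longrightarrow> (\<lambda>n. t n x) \<longlonglongrightarrow> g x"
    using baire_one_funsE[OF assms(2)] by metis
  show ?thesis
    by (rule baire_one_funsI[where s = "\<lambda>n x. s n x * t n x"])
      (auto intro!: continuous_map_real_mult tendsto_mult s t)
qed

lemma cring_B1: "cring (B1 X)"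
proof (rule cringI)
  have outside: "f x = undefined" if "f \<in> baire_one_funs X" "x \<notin> topspace X" for f x
    using that unfolding baire_one_funs_def extensional_def by auto
  show "abelian_group (B1 X)"
  proof (rule abelian_groupI)
    fix f assume f: "f \<in> carrier (B1 X)"
    then have fB: "f \<in> baire_one_funs X" by (simp add: B1_def)
    have "(\<lambda>x\<in>topspace X. (\<lambda>x\<in>topspace X. -1) x * f x) \<in> baire_one_funs X"
      by (rule baire_one_funs_mult[OF baire_one_funs_const fB])
    then show "\<exists>g\<in>carrier (B1 X). g \<oplus>\<^bsub>B1 X\<^esub> f = \<zero>\<^bsub>B1 X\<^esub>"
      by (rule_tac bexI[where x = "\<lambda>x\<in>topspace X. (\<lambda>x\<in>topspace X. -1) x * f x"])
        (auto simp: B1_def fun_eq_iff)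
    show "\<zero>\<^bsub>B1 X\<^esub> \<oplus>\<^bsub>B1 X\<^esub> f = f"
      using outside[OF fB] by (auto simp: B1_def fun_eq_iff)
  qed (auto simp: B1_def baire_one_funs_add baire_one_funs_const fun_eq_iff)
  show "comm_monoid (B1 X)"
    by (rule comm_monoidI)
      (auto simp: B1_def baire_one_funs_mult baire_one_funs_const fun_eq_iff outside)
qed (auto simp: B1_def fun_eq_iff algebra_simps)

lemma subcring_B1_bounded: "subcring (carrier (B1_bounded X)) (B1 X)"
proof (rule cring.subcringI')
  interpret cring "B1 X" by (rule cring_B1)
  show "cring (B1 X)" by (rule cring_B1)
  show "subring (carrier (B1_bounded X)) (B1 X)"
  proof (rule subringI)
    show "carrier (B1_bounded X) \<subseteq> carrier (B1 X)"
      by (auto simp: B1_bounded_def)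
    have "bounded ((\<lambda>x\<in>topspace X. 1 :: real) ` topspace X)"
      by (rule bounded_subset[of "{1}"]) auto
    then show "\<one>\<^bsub>B1 X\<^esub> \<in> carrier (B1_bounded X)"
      using baire_one_funs_const[of 1 X] by (simp add: B1_bounded_def B1_def)
    fix f assume f: "f \<in> carrier (B1_bounded X)"
    then have fB: "f \<in> carrier (B1 X)" and fb: "bounded (f ` topspace X)"
      by (auto simp: B1_bounded_def)
    have inv: "(\<ominus>\<^bsub>B1 X\<^esub> f) x = - f x" if "x \<in> topspace X" for x
      using fun_cong[OF l_neg[OF fB], of x] that by (simp add: B1_def)
    have "(\<ominus>\<^bsub>B1 X\<^esub> f) ` topspace X = uminus ` f ` topspace X"
      by (auto simp: inv image_image)
    then show "\<ominus>\<^bsub>B1 X\<^esub> f \<in> carrier (B1_bounded X)"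
      using a_inv_closed[OF fB] fb by (simp add: B1_bounded_def)
    fix g assume g: "g \<in> carrier (B1_bounded X)"
    then have gB: "g \<in> carrier (B1 X)" and gb: "bounded (g ` topspace X)"
      by (auto simp: B1_bounded_def)
    obtain a where a: "\<And>x. x \<in> topspace X \<Longrightarrow> \<bar>f x\<bar> \<le> a"
      using fb by (auto simp: bounded_iff)
    obtain b where b: "\<And>x. x \<in> topspace X \<Longrightarrow> \<bar>g x\<bar> \<le> b"
      using gb by (auto simp: bounded_iff)
    have "bounded ((f \<oplus>\<^bsub>B1 X\<^esub> g) ` topspace X)"
      unfolding bounded_iff
    proof (intro exI[of _ "a + b"] ballI)
      fix y assume "y \<in> (f \<oplus>\<^bsub>B1 X\<^esub> g) ` topspace X"
      then obtain x where "x \<in> topspace X" "y = f x + g x"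
        by (auto simp: B1_def)
      then show "norm y \<le> a + b"
        using a[of x] b[of x] by simp
    qed
    then show "f \<oplus>\<^bsub>B1 X\<^esub> g \<in> carrier (B1_bounded X)"
      using a_closed[OF fB gB] by (simp add: B1_bounded_def)
    have "bounded ((f \<otimes>\<^bsub>B1 X\<^esub> g) ` topspace X)"
      unfolding bounded_iff
    proof (intro exI[of _ "a * b"] ballI)
      fix y assume "y \<in> (f \<otimes>\<^bsub>B1 X\<^esub> g) ` topspace X"
      then obtain x where x: "x \<in> topspace X" "y = f x * g x"
        by (auto simp: B1_def)
      have "\<bar>f x\<bar> * \<bar>g x\<bar> \<le> a * b"
        by (rule mult_mono') (use a[OF x(1)] b[OF x(1)] in auto)
      then show "norm y \<le> a * b"
        using x by (simp add: abs_mult)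
    qed
    then show "f \<otimes>\<^bsub>B1 X\<^esub> g \<in> carrier (B1_bounded X)"
      using m_closed[OF fB gB] by (simp add: B1_bounded_def)
  qed
qed

end

theory Submission imports Defs begin

text \<open>
  The space \<open>Y\<close> is the Tychonoff reflection of \<open>X\<close>: the image of \<open>X\<close> under the evaluation map
  \<open>x \<mapsto> (f x)\<^sub>f\<close> into the power of the real line indexed by all continuous real functions on \<open>X\<close>.
  A subspace of a power of the reals is Tychonoff, and every continuous function on \<open>X\<close> factors
  through the evaluation map, because it is evaluation followed by one of the projections
  (\<open>tychonoff_reflection\<close>).

  Composition with such a map \<open>q\<close> is then a ring isomorphism from \<open>B\<^sub>1(Y)\<close> to \<open>B\<^sub>1(X)\<close>. It is
  injective because \<open>q\<close> is onto. It is onto because the continuous functions that converge to a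
  Baire one function on \<open>X\<close> all factor through \<open>q\<close>, and their factors must converge at every point
  of \<open>Y = q(X)\<close>; the limit of the factors is the required preimage. A function on \<open>Y\<close> and its
  composite with \<open>q\<close> take the same values, so boundedness is preserved in both directions.
\<close>

text \<open>
  The reflection naturally lives in a function space; this lemma moves it to the type in which its
  points are the fibres of the evaluation map.
\<close>
lemma homeomorphic_copy_along_injection:
  assumes inj: "inj_on h (topspace Z)"
  obtains Y where "homeomorphic_map Z Y h"
proof -
  define k where "k = inv_into (topspace Z) h"
  define Y where "Y = pullback_topology (h ` topspace Z) k Z"
  have kh: "k (h z) = z" if "z \<in> topspace Z" for z
    unfolding k_def using inj that by (rule inv_into_f_f)
  have top: "topspace Y = h ` topspace Z"
    by (auto simp: Y_def topspace_pullback_topology kh)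
  have "continuous_map Z Y h"
    unfolding Y_def
  proof (rule continuous_map_pullback')
    show "continuous_map Z Z (k \<circ> h)"
      by (rule continuous_map_eq[OF continuous_map_id]) (simp add: kh)
  qed auto
  moreover have "continuous_map Y Z k"
    unfolding Y_def using continuous_map_pullback[OF continuous_map_id] by simp
  ultimately have "homeomorphic_maps Z Y h k"
    unfolding homeomorphic_maps_def by (auto simp: top kh)
  then show thesis
    using that homeomorphic_maps_map by blast
qed

lemma tychonoff_space_subspace_of_real_power:
  "tychonoff_space (subtopology (product_topology (\<lambda>_. euclideanreal) I) S)"
  unfolding tychonoff_space_def
  by (simp add: completely_regular_space_subtopology completely_regular_space_product_topology
      metrizable_imp_completely_regular_space metrizable_space_euclidean Hausdorff_space_subtopology
      Hausdorff_space_product_topology)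

lemma homeomorphic_tychonoff_space:
  assumes "X homeomorphic_space Y"
  shows "tychonoff_space X \<longleftrightarrow> tychonoff_space Y"
  unfolding tychonoff_space_def
  using homeomorphic_completely_regular_space[OF assms] homeomorphic_Hausdorff_space[OF assms]
  by simp

text \<open>
  The target of the evaluation map is cut down to its image, so that the map becomes onto; the
  factor of \<open>f\<close> is the projection to the coordinate \<open>f\<close>.
\<close>
lemma tychonoff_reflection:
  fixes X :: "'a topology"
  obtains Y :: "'a set topology" and q
  where "tychonoff_space Y" and "continuous_map X Y q" and "q ` topspace X = topspace Y"
    and "\<And>f. continuous_map X euclideanreal f \<Longrightarrow>
      \<exists>g. continuous_map Y euclideanreal g \<and> (\<forall>x\<in>topspace X. g (q x) = f x)"
proof -
  define P where
    "P = product_topology (\<lambda>_ :: 'a \<Rightarrow> real. euclideanreal) {f. continuous_map X euclideanreal f}"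
  define e where "e x = (\<lambda>f\<in>{f. continuous_map X euclideanreal f}. f x)" for x
  define Z where "Z = subtopology P (e ` topspace X)"
  have "continuous_map X P e"
    by (auto simp: P_def e_def continuous_map_componentwise)
  then have cont_e: "continuous_map X Z e"
    unfolding Z_def by (simp add: continuous_map_in_subtopology)
  have onto_e: "e ` topspace X = topspace Z"
    using continuous_map_image_subset_topspace[OF \<open>continuous_map X P e\<close>]
    by (auto simp: Z_def)
  define fibre where "fibre z = {x \<in> topspace X. e x = z}" for z
  have "inj_on fibre (topspace Z)"
    unfolding onto_e[symmetric] by (rule inj_onI) (auto simp: fibre_def)
  then obtain Y where Y: "homeomorphic_map Z Y fibre"
    by (rule homeomorphic_copy_along_injection)
  then obtain k where k: "homeomorphic_maps Z Y fibre k"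
    by (auto simp: homeomorphic_map_maps)
  show thesis
  proof
    have "tychonoff_space Z"
      unfolding Z_def P_def by (rule tychonoff_space_subspace_of_real_power)
    then show "tychonoff_space Y"
      using Y homeomorphic_tychonoff_space homeomorphic_map_imp_homeomorphic_space by blast
    show "continuous_map X Y (fibre \<circ> e)"
      using cont_e homeomorphic_imp_continuous_map[OF Y] by (rule continuous_map_compose)
    show "(fibre \<circ> e) ` topspace X = topspace Y"
      using homeomorphic_imp_surjective_map[OF Y] by (simp only: image_comp[symmetric] onto_e)
    fix f assume f: "continuous_map X euclideanreal f"
    have "continuous_map P euclideanreal (\<lambda>z. z f)"
      unfolding P_def using f by (intro continuous_map_product_projection) simp
    then have "continuous_map Z euclideanreal (\<lambda>z. z f)"
      unfolding Z_def by (rule continuous_map_from_subtopology)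
    moreover have "continuous_map Y Z k"
      using k by (simp add: homeomorphic_maps_def)
    ultimately have "continuous_map Y euclideanreal ((\<lambda>z. z f) \<circ> k)"
      by (rule continuous_map_compose[rotated])
    moreover have "((\<lambda>z. z f) \<circ> k) ((fibre \<circ> e) x) = f x" if "x \<in> topspace X" for x
    proof -
      have "e x \<in> topspace Z"
        using that onto_e by blast
      then have "k (fibre (e x)) = e x"
        using k by (simp add: homeomorphic_maps_def)
      then show ?thesis
        using f by (simp add: e_def)
    qed
    ultimately show "\<exists>g. continuous_map Y euclideanreal g \<and>
        (\<forall>x\<in>topspace X. g ((fibre \<circ> e) x) = f x)"
      by blast
  qed
qed

lemma baire_one_funs_compose:
  assumes q: "continuous_map X Y q" and F: "F \<in> baire_one_funs Y"
  shows "(\<lambda>x\<in>topspace X. F (q x)) \<in> baire_one_funs X"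
proof -
  obtain s where s: "\<And>n. continuous_map Y euclideanreal (s n)"
      "\<And>y. y \<in> topspace Y \<Longrightarrow> (\<lambda>n. s n y) \<longlonglongrightarrow> F y"
    using baire_one_funsE[OF F] by metis
  show ?thesis
  proof (rule baire_one_funsI)
    show "continuous_map X euclideanreal (s n \<circ> q)" for n
      using q s(1) by (rule continuous_map_compose)
    show "(\<lambda>n. (s n \<circ> q) x) \<longlonglongrightarrow> (\<lambda>x\<in>topspace X. F (q x)) x" if "x \<in> topspace X" for x
      using that s(2) continuous_map_image_subset_topspace[OF q] by auto
  qed simp
qed

text \<open>
  Factoring passes from continuous to Baire one functions: if \<open>s\<^sub>n\<close> tends to \<open>f\<close> and
  \<open>s\<^sub>n = t\<^sub>n \<circ> q\<close>, then \<open>t\<^sub>n\<close> converges at every point, since every point of \<open>Y\<close> is some \<open>q x\<close>. In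
  particular \<open>f\<close> is constant on the fibres of \<open>q\<close>.
\<close>
lemma baire_one_funs_factor:
  assumes onto: "q ` topspace X = topspace Y"
    and factor: "\<And>f. continuous_map X euclideanreal f \<Longrightarrow>
      \<exists>g. continuous_map Y euclideanreal g \<and> (\<forall>x\<in>topspace X. g (q x) = f x)"
    and f: "f \<in> baire_one_funs X"
  obtains F where "F \<in> baire_one_funs Y" and "(\<lambda>x\<in>topspace X. F (q x)) = f"
proof -
  obtain s where ext: "f \<in> extensional (topspace X)"
    and s: "\<And>n. continuous_map X euclideanreal (s n)"
      "\<And>x. x \<in> topspace X \<Longrightarrow> (\<lambda>n. s n x) \<longlonglongrightarrow> f x"
    using baire_one_funsE[OF f] by metis
  obtain t where t: "\<And>n. continuous_map Y euclideanreal (t n)"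
      "\<And>n x. x \<in> topspace X \<Longrightarrow> t n (q x) = s n x"
    using factor[OF s(1)] by metis
  define F where "F = (\<lambda>y\<in>topspace Y. lim (\<lambda>n. t n y))"
  have lim_t: "(\<lambda>n. t n (q x)) \<longlonglongrightarrow> f x" if "x \<in> topspace X" for x
    using s(2) t(2) that by simp
  have Fq: "F (q x) = f x" if "x \<in> topspace X" for x
    using limI[OF lim_t[OF that]] that onto by (auto simp: F_def)
  have "F \<in> baire_one_funs Y"
  proof (rule baire_one_funsI[OF _ t(1)])
    fix y assume "y \<in> topspace Y"
    then obtain x where "x \<in> topspace X" "y = q x"
      using onto by blast
    then show "(\<lambda>n. t n y) \<longlonglongrightarrow> F y"
      using lim_t Fq by simp
  qed (simp add: F_def)
  moreover have "(\<lambda>x\<in>topspace X. F (q x)) = f"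
    using Fq ext by (auto simp: fun_eq_iff extensional_def)
  ultimately show thesis
    by (rule that)
qed

lemma compose_ring_iso_B1:
  assumes q: "continuous_map X Y q" and onto: "q ` topspace X = topspace Y"
    and factor: "\<And>f. continuous_map X euclideanreal f \<Longrightarrow>
      \<exists>g. continuous_map Y euclideanreal g \<and> (\<forall>x\<in>topspace X. g (q x) = f x)"
  shows "(\<lambda>F. \<lambda>x\<in>topspace X. F (q x)) \<in> ring_iso (B1 Y) (B1 X)" (is "?\<phi> \<in> _")
proof -
  have qY: "q x \<in> topspace Y" if "x \<in> topspace X" for x
    using that onto by blast
  have "?\<phi> \<in> ring_hom (B1 Y) (B1 X)"
    by (rule ring_hom_memI)
      (auto simp: B1_def baire_one_funs_compose[OF q] fun_eq_iff qY)
  moreover have "inj_on ?\<phi> (carrier (B1 Y))"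
  proof (rule inj_onI)
    fix F G assume FG: "F \<in> carrier (B1 Y)" "G \<in> carrier (B1 Y)" and eq: "?\<phi> F = ?\<phi> G"
    show "F = G"
    proof (rule extensionalityI)
      show "F \<in> extensional (topspace Y)" "G \<in> extensional (topspace Y)"
        using FG by (simp_all add: B1_def baire_one_funs_def)
      fix y assume "y \<in> topspace Y"
      then obtain x where "x \<in> topspace X" "y = q x"
        using onto by blast
      then show "F y = G y"
        using fun_cong[OF eq, of x] by simp
    qed
  qed
  moreover have "?\<phi> ` carrier (B1 Y) = carrier (B1 X)"
  proof
    show "?\<phi> ` carrier (B1 Y) \<subseteq> carrier (B1 X)"
      by (auto simp: B1_def baire_one_funs_compose[OF q])
    show "carrier (B1 X) \<subseteq> ?\<phi> ` carrier (B1 Y)"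
    proof
      fix f assume "f \<in> carrier (B1 X)"
      then have "f \<in> baire_one_funs X" by (simp add: B1_def)
      then obtain F where "F \<in> baire_one_funs Y" "?\<phi> F = f"
        using baire_one_funs_factor[OF onto factor] by blast
      then show "f \<in> ?\<phi> ` carrier (B1 Y)"
        by (auto simp: B1_def)
    qed
  qed
  ultimately show ?thesis
    by (simp add: ring_iso_def bij_betw_def)
qed

text \<open>
  The equivalence in the hypothesis serves both directions: one makes the restriction well defined,
  the other makes it onto.
\<close>
lemma restrict_ring_iso_B1_bounded:
  assumes iso: "\<phi> \<in> ring_iso (B1 Y) (B1 X)"
    and bdd: "\<And>F. F \<in> carrier (B1 Y) \<Longrightarrow>
      bounded (\<phi> F ` topspace X) \<longleftrightarrow> bounded (F ` topspace Y)"
  shows "restrict \<phi> (carrier (B1_bounded Y)) \<in> ring_iso (B1_bounded Y) (B1_bounded X)"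
proof -
  have hom: "\<phi> \<in> ring_hom (B1 Y) (B1 X)" and bij: "bij_betw \<phi> (carrier (B1 Y)) (carrier (B1 X))"
    using iso by (auto simp: ring_iso_def)
  note subcring = subcringE[OF subcring_B1_bounded[of Y]]
  have ops: "mult (B1_bounded Z) = mult (B1 Z)" "add (B1_bounded Z) = add (B1 Z)"
    "one (B1_bounded Z) = one (B1 Z)" for Z :: "'z topology"
    by (simp_all add: B1_bounded_def)
  have "bij_betw \<phi> (carrier (B1_bounded Y)) (carrier (B1_bounded X))"
  proof (rule bij_betw_subset[OF bij subcring(1)])
    show "\<phi> ` carrier (B1_bounded Y) = carrier (B1_bounded X)"
    proof
      show "\<phi> ` carrier (B1_bounded Y) \<subseteq> carrier (B1_bounded X)"
        using bij_betwE[OF bij] bdd by (auto simp: B1_bounded_def)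
      show "carrier (B1_bounded X) \<subseteq> \<phi> ` carrier (B1_bounded Y)"
      proof
        fix f assume f: "f \<in> carrier (B1_bounded X)"
        then have "f \<in> \<phi> ` carrier (B1 Y)"
          using bij_betw_imp_surj_on[OF bij] by (simp add: B1_bounded_def)
        then obtain F where "F \<in> carrier (B1 Y)" "f = \<phi> F"
          by blast
        then show "f \<in> \<phi> ` carrier (B1_bounded Y)"
          using f bdd by (simp add: B1_bounded_def)
      qed
    qed
  qed
  then have bij': "bij_betw (restrict \<phi> (carrier (B1_bounded Y)))
      (carrier (B1_bounded Y)) (carrier (B1_bounded X))"
    by simp
  have "restrict \<phi> (carrier (B1_bounded Y)) \<in> ring_hom (B1_bounded Y) (B1_bounded X)"
  proof (rule ring_hom_memI)
    show "restrict \<phi> (carrier (B1_bounded Y)) F \<in> carrier (B1_bounded X)"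
      if "F \<in> carrier (B1_bounded Y)" for F
      using bij_betwE[OF bij'] that by blast
  qed (simp_all add: ops subcring(3,6,7) subsetD[OF subcring(1)]
      ring_hom_mult[OF hom] ring_hom_add[OF hom] ring_hom_one[OF hom])
  then show ?thesis
    using bij' by (simp add: ring_iso_def)
qed

theorem theorem2p1:
  fixes X :: "'a topology"
  shows "\<exists>(Y :: 'a set topology) \<phi>.
    tychonoff_space Y \<and>
    \<phi> \<in> ring_iso (B1 Y) (B1 X) \<and>
    restrict \<phi> (carrier (B1_bounded Y)) \<in> ring_iso (B1_bounded Y) (B1_bounded X)"
proof -
  obtain Y :: "'a set topology" and q
    where Y: "tychonoff_space Y" and q: "continuous_map X Y q" "q ` topspace X = topspace Y"
      "\<And>f. continuous_map X euclideanreal f \<Longrightarrow>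
        \<exists>g. continuous_map Y euclideanreal g \<and> (\<forall>x\<in>topspace X. g (q x) = f x)"
    using tychonoff_reflection[of X] by metis
  let ?\<phi> = "\<lambda>F. \<lambda>x\<in>topspace X. F (q x)"
  have iso: "?\<phi> \<in> ring_iso (B1 Y) (B1 X)"
    using q by (rule compose_ring_iso_B1)
  have "?\<phi> F ` topspace X = F ` topspace Y" for F :: "'a set \<Rightarrow> real"
    by (simp add: q(2)[symmetric] image_image)
  then have "restrict ?\<phi> (carrier (B1_bounded Y)) \<in> ring_iso (B1_bounded Y) (B1_bounded X)"
    by (intro restrict_ring_iso_B1_bounded[OF iso]) simp
  with Y iso show ?thesis
    by blast
qed

end
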